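(* For every odd integer $n\ge 1$, $\chi_{la}(FB(n)) = 3$.
   Context: All graphs are finite and simple. For a graph $G=(V,E)$ with $q=|E|$ edges, a bijection $f:E\to\{1,2,\dots,q\}$ is a local antimagic labeling of $G$ if $f^+(u)\ne f^+(v)$ for every edge $uv\in E$, where $f^+(u)=\sum_{e\in E(u)}f(e)$ and $E(u)$ is the set of edges incident to $u$. The color number $c(f)$ is the number of distinct values of $f^+$ on $V$. The local antimagic chromatic number $\chi_{la}(G)$ is the minimum of $c(f)$ over all local antimagic labelings $f$ of $G$. $P_3$ is the path on 3 vertices, $nP_3$ is the disjoint union of $n$ copies of $P_3$, $O_m$ is the null (edgeless) graph on $m$ vertices, and $G\vee H$ is the join of $G$ and $H$ (disjoint union together with all edges between $G$ and $H$). $FB(n)=nP_3\vee O_1$ is the fan graph with $n$ blades. *)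

theory Defs
  imports Main "HOL-Library.Extended_Nat"
begin

text \<open>An undirected graph is a pair of its vertex set and its edge set, an edge being the
  two-element set of its endpoints.\<close>

type_synonym 'a ugraph = "'a set \<times> 'a set set"

abbreviation verts :: "'a ugraph \<Rightarrow> 'a set" where
  "verts G \<equiv> fst G"

abbreviation edges :: "'a ugraph \<Rightarrow> 'a set set" where
  "edges G \<equiv> snd G"

definition finite_simple_graph :: "'a ugraph \<Rightarrow> bool" where
  "finite_simple_graph G \<longleftrightarrow>
     finite (verts G) \<and> (\<forall>e\<in>edges G. e \<subseteq> verts G \<and> card e = 2)"

definition incident_edges :: "'a ugraph \<Rightarrow> 'a \<Rightarrow> 'a set set" where
  "incident_edges G u = {e \<in> edges G. u \<in> e}"

definition vertex_sum :: "'a ugraph \<Rightarrow> ('a set \<Rightarrow> nat) \<Rightarrow> 'a \<Rightarrow> nat" where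
  "vertex_sum G f u = (\<Sum>e\<in>incident_edges G u. f e)"

definition local_antimagic_labeling :: "'a ugraph \<Rightarrow> ('a set \<Rightarrow> nat) \<Rightarrow> bool" where
  "local_antimagic_labeling G f \<longleftrightarrow>
     bij_betw f (edges G) {1..card (edges G)} \<and>
     (\<forall>u v. {u, v} \<in> edges G \<longrightarrow> vertex_sum G f u \<noteq> vertex_sum G f v)"

definition color_number :: "'a ugraph \<Rightarrow> ('a set \<Rightarrow> nat) \<Rightarrow> nat" where
  "color_number G f = card (vertex_sum G f ` verts G)"

text \<open>The minimum is taken in \<^typ>\<open>enat\<close>, so that a graph without any local antimagic
  labeling gets the value \<open>\<infinity>\<close>; a finite value is always attained by some labeling.\<close>

definition chi_la :: "'a ugraph \<Rightarrow> enat" where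
  "chi_la G = (INF f \<in> {f. local_antimagic_labeling G f}. enat (color_number G f))"

definition path_graph :: "nat \<Rightarrow> nat ugraph" where
  "path_graph k = ({..<k}, {{i, Suc i} |i. Suc i < k})"

definition null_graph :: "nat \<Rightarrow> nat ugraph" where
  "null_graph m = ({..<m}, {})"

definition disjoint_copies :: "nat \<Rightarrow> 'a ugraph \<Rightarrow> (nat \<times> 'a) ugraph" where
  "disjoint_copies n G = ({..<n} \<times> verts G, {Pair i ` e |i e. i < n \<and> e \<in> edges G})"

definition graph_join :: "'a ugraph \<Rightarrow> 'b ugraph \<Rightarrow> ('a + 'b) ugraph" where
  "graph_join G H =
     (verts G <+> verts H,
      (`) Inl ` edges G \<union> (`) Inr ` edges H \<union>
      {{Inl u, Inr v} |u v. u \<in> verts G \<and> v \<in> verts H})"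

definition fan_graph :: "nat \<Rightarrow> ((nat \<times> nat) + nat) ugraph" where
  "fan_graph n = graph_join (disjoint_copies n (path_graph 3)) (null_graph 1)"

lemma finite_simple_graph_path: "finite_simple_graph (path_graph k)"
  by (auto simp: finite_simple_graph_def path_graph_def)

lemma finite_simple_graph_null: "finite_simple_graph (null_graph m)"
  by (auto simp: finite_simple_graph_def null_graph_def)

lemma finite_simple_graph_copies:
  assumes "finite_simple_graph G"
  shows "finite_simple_graph (disjoint_copies n G)"
  using assms by (fastforce simp: finite_simple_graph_def disjoint_copies_def card_image inj_on_def)

lemma finite_simple_graph_join:
  assumes "finite_simple_graph G" "finite_simple_graph H"
  shows "finite_simple_graph (graph_join G H)"
  using assms by (fastforce simp: finite_simple_graph_def graph_join_def card_image inj_on_def)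

lemma finite_simple_graph_fan: "finite_simple_graph (fan_graph n)"
  unfolding fan_graph_def
  by (intro finite_simple_graph_join finite_simple_graph_copies
      finite_simple_graph_path finite_simple_graph_null)

end

theory Submission
  imports Defs
begin

text \<open>A triangle forces three colors. For the upper bound, give the two path edges of blade \<open>i\<close>
  labels \<open>x\<^sub>i, y\<^sub>i\<close> that partition \<open>{1..2n}\<close>, give the spokes to its leaves the complementary
  labels \<open>4n + 1 - x\<^sub>i, 4n + 1 - y\<^sub>i\<close>, and give the spoke to its middle vertex a label
  \<open>m\<^sub>i > 4n\<close>. All leaves then have sum \<open>4n + 1\<close>. Since \<open>n\<close> is odd, \<open>x\<^sub>i, y\<^sub>i\<close> can be chosen with
  \<open>x\<^sub>i + y\<^sub>i\<close> running through \<open>n\<close> consecutive integers, and the choice of \<open>m\<^sub>i\<close> makes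
  \<open>x\<^sub>i + y\<^sub>i + m\<^sub>i\<close> constant.\<close>

text \<open>Adjacent vertices have different sums, so the corners of a triangle show three values
  under every labeling, which bounds the infimum from below.\<close>

lemma chi_la_ge_3_if_triangle:
  assumes "finite (verts G)" and "{u, v, w} \<subseteq> verts G"
    and "{u, v} \<in> edges G" "{v, w} \<in> edges G" "{u, w} \<in> edges G"
  shows "3 \<le> chi_la G"
  unfolding chi_la_def
proof (rule INF_greatest)
  fix f assume "f \<in> {f. local_antimagic_labeling G f}"
  then have "card {vertex_sum G f u, vertex_sum G f v, vertex_sum G f w} = 3"
    using assms by (simp add: local_antimagic_labeling_def)
  moreover have "card {vertex_sum G f u, vertex_sum G f v, vertex_sum G f w} \<le> color_number G f"
    unfolding color_number_def using assms by (intro card_mono) auto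
  ultimately have "enat 3 \<le> enat (color_number G f)"
    by simp
  then show "3 \<le> enat (color_number G f)"
    by (simp add: numeral_eq_enat)
qed

text \<open>Numbers the edges of blade \<open>i\<close>: 0 and 1 are the path edges, 2 to 4 the
  spokes to the path vertices 0, 1 and 2. A labeling can thus be given on index pairs.\<close>

definition fan_edge :: "nat \<Rightarrow> nat \<Rightarrow> ((nat \<times> nat) + nat) set" where
  "fan_edge i j =
     (if j < 2 then {Inl (i, j), Inl (i, Suc j)} else {Inl (i, j - 2), Inr 0})"

lemma less_3_cases: "j < 3 \<longleftrightarrow> j = 0 \<or> j = 1 \<or> j = (2::nat)"
  by auto

lemma less_5_cases: "j < 5 \<longleftrightarrow> j = 0 \<or> j = 1 \<or> j = 2 \<or> j = 3 \<or> j = (4::nat)"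
  by auto

lemma verts_fan_graph: "verts (fan_graph n) = Inl ` ({..<n} \<times> {..<3}) \<union> {Inr 0}"
  by (auto simp: fan_graph_def graph_join_def disjoint_copies_def path_graph_def null_graph_def)

lemma edges_fan_graph:
  "edges (fan_graph n) = (\<lambda>(i, j). fan_edge i j) ` ({..<n} \<times> {..<5})" (is "?E = ?F")
proof
  have fan_edge_mem: "fan_edge i j \<in> ?F" if "i < n" "j < 5" for i j
    using that by auto
  show "?E \<subseteq> ?F"
  proof
    fix e assume "e \<in> ?E"
    then consider i j where "i < n" "j < 2" "e = {Inl (i, j), Inl (i, Suc j)}"
      | i j where "i < n" "j < 3" "e = {Inl (i, j), Inr 0}"
      by (fastforce simp: fan_graph_def graph_join_def disjoint_copies_def path_graph_def
          null_graph_def)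
    then show "e \<in> ?F"
    proof cases
      case 1
      then have "e = fan_edge i j" "j < 5" by (simp_all add: fan_edge_def)
      with 1 fan_edge_mem[of i j] show ?thesis by (simp only:)
    next
      case 2
      then have "e = fan_edge i (j + 2)" "j + 2 < 5" by (simp_all add: fan_edge_def)
      with 2 fan_edge_mem[of i "j + 2"] show ?thesis by (simp only:)
    qed
  qed
next
  have path: "fan_edge i j \<in> ?E" if "i < n" "j < 2" for i j
  proof -
    have "{j, Suc j} \<in> edges (path_graph 3)"
      using that by (auto simp: path_graph_def)
    then have "Pair i ` {j, Suc j} \<in> edges (disjoint_copies n (path_graph 3))"
      using that unfolding disjoint_copies_def snd_conv by blast
    then have "Inl ` Pair i ` {j, Suc j} \<in> ?E"
      unfolding fan_graph_def graph_join_def snd_conv by blast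
    with that show ?thesis
      by (simp add: fan_edge_def)
  qed
  have spoke: "fan_edge i j \<in> ?E" if "i < n" "\<not> j < 2" "j < 5" for i j
  proof -
    have "(i, j - 2) \<in> verts (disjoint_copies n (path_graph 3))" "0 \<in> verts (null_graph 1)"
      using that by (auto simp: disjoint_copies_def path_graph_def null_graph_def)
    then have "{Inl (i, j - 2), Inr 0} \<in> ?E"
      unfolding fan_graph_def graph_join_def snd_conv by blast
    with that show ?thesis
      by (simp add: fan_edge_def)
  qed
  show "?F \<subseteq> ?E"
    using path spoke by auto
qed

lemma inj_on_fan_edge: "inj_on (\<lambda>(i, j). fan_edge i j) ({..<n} \<times> {..<5})"
  by (auto simp: inj_on_def fan_edge_def doubleton_eq_iff split: if_splits)

text \<open>The numbering of edges is injective, so each sum can be taken over the index pairs whose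
  edge contains the vertex.\<close>

lemma vertex_sum_fan_graph:
  shows "i < n \<Longrightarrow> vertex_sum (fan_graph n) f (Inl (i, 0)) =
      f (fan_edge i 0) + f (fan_edge i 2)"
    and "i < n \<Longrightarrow> vertex_sum (fan_graph n) f (Inl (i, 1)) =
      f (fan_edge i 0) + f (fan_edge i 1) + f (fan_edge i 3)"
    and "i < n \<Longrightarrow> vertex_sum (fan_graph n) f (Inl (i, 2)) =
      f (fan_edge i 1) + f (fan_edge i 4)"
    and "vertex_sum (fan_graph n) f (Inr 0) =
      (\<Sum>i<n. f (fan_edge i 2) + f (fan_edge i 3) + f (fan_edge i 4))"
proof -
  let ?A = "\<lambda>v. {(i, j) \<in> {..<n} \<times> {..<5}. v \<in> fan_edge i j}"
  have sum: "vertex_sum (fan_graph n) f v = (\<Sum>(i, j)\<in>?A v. f (fan_edge i j))" for v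
  proof -
    have "incident_edges (fan_graph n) v = (\<lambda>(i, j). fan_edge i j) ` ?A v"
      by (auto simp: incident_edges_def edges_fan_graph)
    moreover have "inj_on (\<lambda>(i, j). fan_edge i j) (?A v)"
      by (rule inj_on_subset[OF inj_on_fan_edge]) auto
    ultimately show ?thesis
      unfolding vertex_sum_def by (simp add: sum.reindex case_prod_unfold)
  qed
  have leaf: "?A (Inl (i, 0)) = {(i, 0), (i, 2)}" "?A (Inl (i, 2)) = {(i, 1), (i, 4)}"
    and middle: "?A (Inl (i, 1)) = {(i, 0), (i, 1), (i, 3)}" if "i < n"
    using that by (auto simp: fan_edge_def less_5_cases split: if_splits)
  have center: "?A (Inr 0) = {..<n} \<times> {2, 3, 4}"
    by (auto simp: fan_edge_def less_5_cases split: if_splits)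
  show "vertex_sum (fan_graph n) f (Inl (i, 0)) = f (fan_edge i 0) + f (fan_edge i 2)"
    and "vertex_sum (fan_graph n) f (Inl (i, 2)) = f (fan_edge i 1) + f (fan_edge i 4)"
    if "i < n"
    unfolding sum leaf[OF that] by simp_all
  show "vertex_sum (fan_graph n) f (Inl (i, 1)) =
      f (fan_edge i 0) + f (fan_edge i 1) + f (fan_edge i 3)" if "i < n"
    unfolding sum middle[OF that] by simp
  show "vertex_sum (fan_graph n) f (Inr 0) =
      (\<Sum>i<n. f (fan_edge i 2) + f (fan_edge i 3) + f (fan_edge i 4))"
    unfolding sum center by (subst sum.cartesian_product[symmetric]) (simp add: add.assoc)
qed

text \<open>As \<open>i\<close> runs through \<open>{0..2k}\<close>, the sum \<open>i + pairing k i\<close> takes each value in \<open>{k..3k}\<close>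
  once: \<open>k..2k\<close> for even \<open>i\<close> and \<open>2k+1..3k\<close> for odd \<open>i\<close>.\<close>

definition pairing :: "nat \<Rightarrow> nat \<Rightarrow> nat" where
  "pairing k i = (if even i then k - i div 2 else 2 * k - i div 2)"

lemma pairing_le: "pairing k i \<le> 2 * k"
  by (auto simp: pairing_def)

text \<open>Even indices take values in \<open>{0..k}\<close> and odd ones in
  \<open>{k+1..2k}\<close>, strictly decreasing in each case.\<close>

lemma pairing_inject:
  assumes "pairing k i = pairing k j" "i < 2 * k + 1" "j < 2 * k + 1"
  shows "i = j"
  using assms by (cases "even i"; cases "even j") (auto simp: pairing_def elim!: evenE oddE)

lemma add_pairing_bounds:
  assumes "i < 2 * k + 1"
  shows "k \<le> i + pairing k i" and "i + pairing k i \<le> 3 * k"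
  using assms by (cases "even i"; auto simp: pairing_def elim!: evenE oddE)+

lemma add_pairing_inject:
  assumes "i + pairing k i = j + pairing k j" "i < 2 * k + 1" "j < 2 * k + 1"
  shows "i = j"
  using assms by (cases "even i"; cases "even j") (auto simp: pairing_def elim!: evenE oddE)

text \<open>The label of \<open>fan_edge i j\<close> in the fan with \<open>2k + 1\<close> blades. With \<open>n = 2k + 1\<close> the
  constants are \<open>n + 1\<close>, \<open>4n\<close>, \<open>4n + 1 + 3k\<close> and \<open>3n\<close>.\<close>

definition fan_label :: "nat \<Rightarrow> nat \<Rightarrow> nat \<Rightarrow> nat" where
  "fan_label k i j =
     (if j = 0 then i + 1
      else if j = 1 then 2 * k + 2 + pairing k i
      else if j = 2 then 8 * k + 4 - i
      else if j = 3 then 11 * k + 5 - (i + pairing k i)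
      else 6 * k + 3 - pairing k i)"

text \<open>The classes \<open>j\<close> = 0, 1, 4, 2, 3 fill, in this order, five consecutive
  blocks of \<open>2k + 1\<close> labels. Injectivity and the range suffice, by counting.\<close>

lemma bij_betw_fan_label:
  "bij_betw (\<lambda>(i, j). fan_label k i j) ({..<2 * k + 1} \<times> {..<5}) {1..5 * (2 * k + 1)}"
proof -
  have inj: "i = i' \<and> j = j'"
    if "i < 2 * k + 1" "i' < 2 * k + 1" "j < 5" "j' < 5" "fan_label k i j = fan_label k i' j'"
    for i j i' j'
  proof -
    note bounds = add_pairing_bounds[OF that(1)] add_pairing_bounds[OF that(2)]
      pairing_le[of k i] pairing_le[of k i']
    have "j = j'"
      using that bounds unfolding fan_label_def less_5_cases by (auto split: if_splits)
    \<comment> \<open>Inside a class the label depends on \<open>i\<close> only through one of these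
      three quantities, each injective in \<open>i\<close>.\<close>
    moreover from this have
      "i = i' \<or> pairing k i = pairing k i' \<or> i + pairing k i = i' + pairing k i'"
      using that bounds unfolding fan_label_def by (auto split: if_splits)
    ultimately show ?thesis
      using that pairing_inject add_pairing_inject by blast
  qed
  have inj': "inj_on (\<lambda>(i, j). fan_label k i j) ({..<2 * k + 1} \<times> {..<5})"
    by (intro inj_onI) (use inj in auto)
  have range: "fan_label k i j \<in> {1..5 * (2 * k + 1)}" if "i < 2 * k + 1" for i j
    using add_pairing_bounds[OF that] pairing_le[of k i] that unfolding fan_label_def by auto
  have "(\<lambda>(i, j). fan_label k i j) ` ({..<2 * k + 1} \<times> {..<5}) = {1..5 * (2 * k + 1)}"
    by (rule card_subset_eq) (use range card_image[OF inj'] in \<open>auto simp: card_cartesian_product\<close>)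
  with inj' show ?thesis
    by (simp add: bij_betw_def)
qed

lemma fan_graph_labeling:
  assumes n: "n = 2 * k + 1"
  obtains f where "local_antimagic_labeling (fan_graph n) f"
    and "color_number (fan_graph n) f \<le> 3"
proof -
  let ?I = "{..<n} \<times> {..<5::nat}"
  let ?e = "\<lambda>(i, j). fan_edge i j"
  let ?G = "fan_graph n"
  define f where "f = (\<lambda>(i, j). fan_label k i j) \<circ> inv_into ?I ?e"
  define W where "W = vertex_sum ?G f (Inr 0)"
  have f_fan_edge: "f (fan_edge i j) = fan_label k i j" if "i < n" "j < 5" for i j
    using inv_into_f_f[OF inj_on_fan_edge, of "(i, j)" n] that by (simp add: f_def)
  \<comment> \<open>In each sum the terms \<open>i\<close> and \<open>pairing k i\<close>
    cancel.\<close>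
  have sums: "vertex_sum ?G f (Inl (i, 0)) = 8 * k + 5"
    "vertex_sum ?G f (Inl (i, 1)) = 13 * k + 8"
    "vertex_sum ?G f (Inl (i, 2)) = 8 * k + 5" if "i < n" for i
    unfolding vertex_sum_fan_graph(1-3)[OF that]
    using that n add_pairing_bounds[of i k] pairing_le[of k i]
    by (simp_all add: f_fan_edge fan_label_def)
  \<comment> \<open>The smallest labels of the three spoke classes are \<open>6k + 4\<close>,
    \<open>8k + 5\<close> and \<open>4k + 3\<close>. Even one blade lifts the center above every
    other sum.\<close>
  have "(\<Sum>i<n. 18 * k + 12) \<le> W"
    unfolding W_def vertex_sum_fan_graph(4)
  proof (rule sum_mono)
    fix i assume "i \<in> {..<n}"
    then show "18 * k + 12 \<le> f (fan_edge i 2) + f (fan_edge i 3) + f (fan_edge i 4)"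
      using n add_pairing_bounds[of i k] pairing_le[of k i]
      by (simp add: f_fan_edge fan_label_def)
  qed
  then have W: "13 * k + 8 < W"
    by (simp add: n algebra_simps)
  have verts_cases: "(\<exists>i<n. v = Inl (i, 0) \<or> v = Inl (i, 1) \<or> v = Inl (i, 2)) \<or> v = Inr 0"
    if "v \<in> verts ?G" for v
    using that by (auto simp: verts_fan_graph less_3_cases)
  have "bij_betw (inv_into ?I ?e) (edges ?G) ?I"
    unfolding edges_fan_graph by (intro bij_betw_inv_into inj_on_imp_bij_betw inj_on_fan_edge)
  then have bij: "bij_betw f (edges ?G) {1..5 * n}"
    unfolding f_def by (rule bij_betw_trans) (simp only: n bij_betw_fan_label)
  have "vertex_sum ?G f u \<noteq> vertex_sum ?G f v" if uv: "{u, v} \<in> edges ?G" for u v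
  proof -
    obtain i j where i: "i < n" and j: "j < 5" and e: "{u, v} = fan_edge i j"
      using uv by (auto simp: edges_fan_graph)
    show ?thesis
      \<comment> \<open>An edge joins a leaf to a middle vertex or either of these to the center,
        and \<open>8k + 5 < 13k + 8 < W\<close>.\<close>
      using j e sums[OF i] W unfolding less_5_cases W_def
      by (auto simp: fan_edge_def doubleton_eq_iff numeral_2_eq_2)
  qed
  with bij have "local_antimagic_labeling ?G f"
    using bij_betw_same_card[OF bij] by (simp add: local_antimagic_labeling_def)
  have "vertex_sum ?G f ` verts ?G \<subseteq> {8 * k + 5, 13 * k + 8, W}"
    using verts_cases sums W_def by blast
  then have "color_number ?G f \<le> card {8 * k + 5, 13 * k + 8, W}"
    unfolding color_number_def by (intro card_mono) auto
  also have "\<dots> \<le> 3"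
    by (simp add: card_insert_if)
  finally have "color_number ?G f \<le> 3" .
  with \<open>local_antimagic_labeling ?G f\<close> show ?thesis
    by (rule that)
qed

theorem theorem2p1:
  fixes n :: nat
  assumes "n \<ge> 1" and "odd n"
  shows "chi_la (fan_graph n) = 3"
proof (rule antisym)
  obtain k where n: "n = 2 * k + 1"
    using assms(2) by (rule oddE)
  obtain f where "local_antimagic_labeling (fan_graph n) f" "color_number (fan_graph n) f \<le> 3"
    using fan_graph_labeling[OF n] by blast
  then have "chi_la (fan_graph n) \<le> enat 3"
    unfolding chi_la_def by (intro INF_lower2[of f]) auto
  then show "chi_la (fan_graph n) \<le> 3"
    by (simp add: numeral_eq_enat)
  have edge: "fan_edge 0 j \<in> edges (fan_graph n)" if "j < 5" for j
    using that assms by (auto simp: edges_fan_graph)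
  show "3 \<le> chi_la (fan_graph n)"
    \<comment> \<open>Edges 0, 2 and 3 of blade 0 form a triangle on a leaf, the middle vertex and
      the center.\<close>
    using finite_simple_graph_fan[of n] edge[of 0] edge[of 2] edge[of 3] assms
    by (intro chi_la_ge_3_if_triangle[of _ "Inl (0, 0)" "Inl (0, 1)" "Inr 0"])
      (auto simp: finite_simple_graph_def verts_fan_graph fan_edge_def)
qed

end
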